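(* Let $X$ be a centered self-decomposable random vector in $\mathbb{R}^d$ with Lévy measure $\nu$ such that $$\int_{\|u\|\ge1}\|u\|\nu(du)<+\infty,\qquad \nu(du)=\mathbf 1_{(0,+\infty)}(r)\mathbf 1_{\mathbb{S}^{d-1}}(x)\frac{k_x(r)}{r}dr\,\sigma(dx),$$ where $\sigma$ is a finite positive measure on $\mathbb{S}^{d-1}$ and where $k_x(r)$ is a nonnegative continuous function decreasing in $r\in(0,+\infty)$, continuous in $x\in\mathbb{S}^{d-1}$, with $\lim_{r\to+\infty}k_x(r)=0$ and $\lim_{r\to0^+}r^2k_x(r)=0$, $x\in\mathbb{S}^{d-1}$. Then, for all $f\in\mathcal{C}_c^\infty(\mathbb{R}^d)$ with $\mathbb{E}f(X)=0$, $$\mathbb{E}f(X)^2\le\mathbb{E}\int_{\mathbb{R}^d}\big(f(X+u)-f(X)\big)^2\nu(du).$$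
   Context: $\|\cdot\|$: Euclidean norm; $\mathbb{S}^{d-1}$: Euclidean unit sphere; polar coordinates $u=rx$. A Lévy measure is a positive Borel measure $\nu$ on $\mathbb{R}^d$ with $\nu(\{0\})=0$ and $\int(1\wedge\|u\|^2)\nu(du)<+\infty$. A self-decomposable random vector (in the paper's convention, without Gaussian component) with Lévy measure $\nu$ has characteristic function $\exp\big(i\langle b;\xi\rangle+\int(e^{i\langle\xi;u\rangle}-1-i\langle\xi;u\rangle\mathbf 1_{\|u\|\le1})\nu(du)\big)$ for some $b\in\mathbb{R}^d$, with $\nu$ of the stated polar form, $k_x(r)\ge0$ non-increasing in $r$, measurable in $x$. Centered means $\mathbb{E}X=0$. $\mathcal{C}_c^\infty(\mathbb{R}^d)$: infinitely differentiable compactly supported (real-valued) functions. *)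

theory Defs
  imports "HOL-Probability.Probability"
begin

definition levy_measure :: "'a::euclidean_space measure \<Rightarrow> bool" where
  "levy_measure \<nu> \<longleftrightarrow>
     sets \<nu> = sets borel \<and> emeasure \<nu> {0} = 0 \<and>
     (\<integral>\<^sup>+u. ennreal (min 1 ((norm u)\<^sup>2)) \<partial>\<nu>) < \<infinity>"

definition finite_sphere_measure :: "'a::euclidean_space measure \<Rightarrow> bool" where
  "finite_sphere_measure \<sigma> \<longleftrightarrow>
     sets \<sigma> = sets (restrict_space borel (sphere 0 1)) \<and> finite_measure \<sigma>"

text \<open>The identity \<open>\<nu>(du) = 1\<^bsub>(0,\<infinity>)\<^esub>(r) 1\<^bsub>S\<^esub>(x) (k\<^sub>x(r) / r) dr \<sigma>(dx)\<close> in polar coordinates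
  \<open>u = r x\<close>, tested on Borel sets. The curried argument order is \<open>k x r\<close>.\<close>

definition has_polar_form ::
    "'a::euclidean_space measure \<Rightarrow> 'a measure \<Rightarrow> ('a \<Rightarrow> real \<Rightarrow> real) \<Rightarrow> bool" where
  "has_polar_form \<nu> \<sigma> k \<longleftrightarrow>
     (\<forall>A\<in>sets borel. emeasure \<nu> A =
        (\<integral>\<^sup>+x. (\<integral>\<^sup>+r\<in>{0<..}. indicator A (r *\<^sub>R x) * ennreal (k x r / r) \<partial>lborel) \<partial>\<sigma>))"

text \<open>The characteristic function of \<open>X\<close> is that of an infinitely divisible law with drift \<open>b\<close>,
  no Gaussian part and Levy measure \<open>\<nu>\<close>, for the truncation at the closed unit ball.\<close>

definition levy_khintchine ::
    "'w measure \<Rightarrow> ('w \<Rightarrow> 'a::euclidean_space) \<Rightarrow> 'a \<Rightarrow> 'a measure \<Rightarrow> bool" where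
  "levy_khintchine M X b \<nu> \<longleftrightarrow>
     (\<forall>\<xi>. (\<integral>\<omega>. exp (\<i> * complex_of_real (\<xi> \<bullet> X \<omega>)) \<partial>M) =
        exp (\<i> * complex_of_real (b \<bullet> \<xi>) +
          (\<integral>u. (exp (\<i> * complex_of_real (\<xi> \<bullet> u)) - 1
               - \<i> * complex_of_real (\<xi> \<bullet> u) * indicator {u. norm u \<le> 1} u) \<partial>\<nu>)))"

text \<open>Self-decomposability of a random vector without Gaussian component, described through its
  Levy measure \<open>\<nu>\<close>.\<close>

definition self_decomposable ::
    "'w measure \<Rightarrow> ('w \<Rightarrow> 'a::euclidean_space) \<Rightarrow> 'a measure \<Rightarrow> bool" where
  "self_decomposable M X \<nu> \<longleftrightarrow>
     X \<in> borel_measurable M \<and> levy_measure \<nu> \<and> (\<exists>b. levy_khintchine M X b \<nu>) \<and>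
     (\<exists>\<sigma> k. finite_sphere_measure \<sigma> \<and> has_polar_form \<nu> \<sigma> k \<and>
        (\<forall>x\<in>sphere 0 1. (\<forall>r>0. 0 \<le> k x r) \<and> antimono_on {0<..} (k x)) \<and>
        (\<forall>r>0. (\<lambda>x. k x r) \<in> borel_measurable \<sigma>))"

definition centered :: "'w measure \<Rightarrow> ('w \<Rightarrow> 'a::euclidean_space) \<Rightarrow> bool" where
  "centered M X \<longleftrightarrow> integrable M X \<and> (\<integral>\<omega>. X \<omega> \<partial>M) = 0"

text \<open>\<open>C_k n f\<close>: all directional derivatives of \<open>f\<close> of order at most \<open>n\<close> exist and are
  continuous; for \<open>n > 0\<close> the function \<open>f' x\<close> below is the Frechet derivative at \<open>x\<close>.\<close>

primrec C_k :: "nat \<Rightarrow> ('a::euclidean_space \<Rightarrow> real) \<Rightarrow> bool" where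
  "C_k 0 f \<longleftrightarrow> continuous_on UNIV f"
| "C_k (Suc n) f \<longleftrightarrow>
     (\<exists>f'. (\<forall>x. (f has_derivative f' x) (at x)) \<and> (\<forall>h. C_k n (\<lambda>x. f' x h)))"

definition Cc_infinity :: "('a::euclidean_space \<Rightarrow> real) set" where
  "Cc_infinity = {f. (\<forall>n. C_k n f) \<and> compact (closure {x. f x \<noteq> 0})}"

end

(* If E exp(i <xi, X>) = exp(Psi xi), then for a trigonometric polynomial f = sum_j a_j e_j with
   frequencies xi_j and c_jl = Psi(xi_j - xi_l) - Psi(xi_j) - Psi(-xi_l), which is the Gram matrix of
   the functions e_j - 1 in L^2(nu), the right-hand side minus the variance of f(X) equals
   sum_jl b_j cnj(b_l) (c_jl exp(c_jl) - exp(c_jl) + 1) with b_j = a_j exp(Psi(xi_j)).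
   The power series of c exp(c) - exp(c) + 1 has nonnegative coefficients and entrywise powers of a
   Gram matrix are positive semidefinite, so this is nonnegative.
   A bounded Lipschitz f is a pointwise limit of uniformly bounded, uniformly Lipschitz trigonometric
   polynomials: apply Bernstein operators in each coordinate, in the variable (1 + sin(x_i / T)) / 2,
   and let T tend to infinity. Dominated convergence concludes. *)
theory Submission
  imports Defs
begin

subsection \<open>Trigonometric polynomials\<close>

text \<open>Induction takes the place of the Schur product theorem: one factor of the power is
  written as an integral and moved outside the double sum. For fixed \<open>u\<close> there remains
  the form of order \<open>n\<close> with coefficients \<open>b j * h j u\<close>, so the induction
  hypothesis, available for every \<open>b\<close>, makes the integrand nonnegative.\<close>

lemma psd_gram_power:
  fixes h :: "'j \<Rightarrow> 'a \<Rightarrow> complex"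
  assumes int: "\<And>j l. integrable N (\<lambda>u. h j u * cnj (h l u))"
  shows "0 \<le> Re (\<Sum>j\<in>J. \<Sum>l\<in>J. b j * cnj (b l) * (\<integral>u. h j u * cnj (h l u) \<partial>N) ^ n)"
proof (induction n arbitrary: b)
  case 0
  have "(\<Sum>j\<in>J. \<Sum>l\<in>J. b j * cnj (b l)) = (\<Sum>j\<in>J. b j) * cnj (\<Sum>j\<in>J. b j)"
    by (simp add: sum_product)
  also have "\<dots> = complex_of_real ((cmod (\<Sum>j\<in>J. b j))\<^sup>2)"
    by (rule complex_norm_square[symmetric])
  finally show ?case by simp
next
  case (Suc n)
  let ?c = "\<lambda>j l. \<integral>u. h j u * cnj (h l u) \<partial>N"
  let ?S = "\<lambda>u. \<Sum>j\<in>J. \<Sum>l\<in>J. (b j * h j u) * cnj (b l * h l u) * ?c j l ^ n"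
  have eq: "(b j * h j u) * cnj (b l * h l u) * ?c j l ^ n
      = (b j * cnj (b l) * ?c j l ^ n) * (h j u * cnj (h l u))" for j l u
    by simp
  have "(\<integral>u. ?S u \<partial>N) = (\<Sum>j\<in>J. \<Sum>l\<in>J. b j * cnj (b l) * ?c j l ^ n * ?c j l)"
    unfolding eq using int by simp
  then have "(\<Sum>j\<in>J. \<Sum>l\<in>J. b j * cnj (b l) * ?c j l ^ Suc n) = (\<integral>u. ?S u \<partial>N)"
    by (simp only: power_Suc2 mult.assoc)
  moreover have "integrable N ?S"
    unfolding eq by (intro Bochner_Integration.integrable_sum integrable_mult_right int)
  ultimately have "Re (\<Sum>j\<in>J. \<Sum>l\<in>J. b j * cnj (b l) * ?c j l ^ Suc n) = (\<integral>u. Re (?S u) \<partial>N)"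
    by (simp only: integral_Re)
  also have "\<dots> \<ge> 0"
    by (intro Bochner_Integration.integral_nonneg Suc.IH)
  finally show ?case .
qed

text \<open>\<open>c * exp c\<close> contributes \<open>n / n!\<close> and \<open>exp c\<close>
  subtracts \<open>1 / n!\<close>; the final \<open>+ 1\<close> cancels the only negative
  coefficient, the one at \<open>n = 0\<close>.\<close>

lemma exp_remainder_sums:
  fixes c :: complex
  shows "(\<lambda>n. of_real (if n = 0 then 0 else (real n - 1) / fact n) * c ^ n)
    sums (c * exp c - exp c + 1)"
proof -
  have e: "(\<lambda>n. c ^ n /\<^sub>R fact n) sums exp c"
    by (rule exp_converges)
  \<comment> \<open>Multiplying the exponential series by \<open>c\<close> shifts its index by one;
    the term at \<open>n = 0\<close> that is put back afterwards vanishes.\<close>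
  have "(\<lambda>n. of_nat (Suc n) * (c ^ Suc n /\<^sub>R fact (Suc n))) sums (c * exp c)"
  proof -
    have "of_nat (Suc n) * (c ^ Suc n /\<^sub>R fact (Suc n)) = c * (c ^ n /\<^sub>R fact n)" for n
      by (simp add: scaleR_conv_of_real field_simps del: of_nat_Suc)
    then show ?thesis
      using sums_mult[OF e, of c] by simp
  qed
  then have "(\<lambda>n. of_nat n * (c ^ n /\<^sub>R fact n)) sums (c * exp c)"
    by (subst (asm) sums_Suc_iff) simp
  from sums_add[OF sums_diff[OF this e] sums_single[of 0 "\<lambda>_. 1"]]
  have "(\<lambda>n. of_nat n * (c ^ n /\<^sub>R fact n) - c ^ n /\<^sub>R fact n + (if n = 0 then 1 else 0))
      sums (c * exp c - exp c + 1)" .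
  moreover have "of_nat n * (c ^ n /\<^sub>R fact n) - c ^ n /\<^sub>R fact n + (if n = 0 then 1 else 0)
      = of_real (if n = 0 then 0 else (real n - 1) / fact n) * c ^ n" for n
    by (simp add: scaleR_conv_of_real field_simps)
  ultimately show ?thesis by simp
qed

lemma psd_exp_remainder:
  fixes h :: "'j \<Rightarrow> 'a \<Rightarrow> complex"
  assumes int: "\<And>j l. integrable N (\<lambda>u. h j u * cnj (h l u))"
  defines "c \<equiv> \<lambda>j l. \<integral>u. h j u * cnj (h l u) \<partial>N"
  shows "0 \<le> Re (\<Sum>j\<in>J. \<Sum>l\<in>J. b j * cnj (b l) * (c j l * exp (c j l) - exp (c j l) + 1))"
proof -
  let ?q = "\<lambda>n. if n = 0 then 0 else (real n - 1) / fact n"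
  have "(\<lambda>n. \<Sum>j\<in>J. \<Sum>l\<in>J. b j * cnj (b l) * (of_real (?q n) * c j l ^ n))
      sums (\<Sum>j\<in>J. \<Sum>l\<in>J. b j * cnj (b l) * (c j l * exp (c j l) - exp (c j l) + 1))"
    by (intro sums_sum sums_mult exp_remainder_sums)
  from sums_Re[OF this]
  have s: "(\<lambda>n. Re (\<Sum>j\<in>J. \<Sum>l\<in>J. b j * cnj (b l) * (of_real (?q n) * c j l ^ n)))
      sums Re (\<Sum>j\<in>J. \<Sum>l\<in>J. b j * cnj (b l) * (c j l * exp (c j l) - exp (c j l) + 1))" .
  have "Re (\<Sum>j\<in>J. \<Sum>l\<in>J. b j * cnj (b l) * (of_real (?q n) * c j l ^ n)) \<ge> 0" for n
  proof -
    have "(\<Sum>j\<in>J. \<Sum>l\<in>J. b j * cnj (b l) * (of_real (?q n) * c j l ^ n))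
        = of_real (?q n) * (\<Sum>j\<in>J. \<Sum>l\<in>J. b j * cnj (b l) * c j l ^ n)"
      unfolding sum_distrib_left by (intro sum.cong refl) (simp add: mult_ac)
    then have "Re (\<Sum>j\<in>J. \<Sum>l\<in>J. b j * cnj (b l) * (of_real (?q n) * c j l ^ n))
        = ?q n * Re (\<Sum>j\<in>J. \<Sum>l\<in>J. b j * cnj (b l) * c j l ^ n)"
      by (simp only: Re_complex_of_real Im_complex_of_real times_complex.simps)
    moreover have "?q n \<ge> 0" by simp
    moreover have "0 \<le> Re (\<Sum>j\<in>J. \<Sum>l\<in>J. b j * cnj (b l) * c j l ^ n)"
      unfolding c_def by (rule psd_gram_power[OF int])
    ultimately show ?thesis
      by (simp only: mult_nonneg_nonneg)
  qed
  then show ?thesis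
    by (rule sums_le[OF _ sums_zero s])
qed

section \<open>Integrability against a Levy measure and factorisation of the characteristic
  function\<close>

lemma levy_measure_integrable_min:
  assumes "levy_measure \<nu>"
  shows "integrable \<nu> (\<lambda>u. min 1 ((norm u)\<^sup>2))"
proof (rule integrableI_nonneg)
  have [measurable_cong]: "sets \<nu> = sets borel"
    using assms by (simp add: levy_measure_def)
  show "(\<lambda>u. min 1 ((norm u)\<^sup>2)) \<in> borel_measurable \<nu>" by measurable
qed (use assms in \<open>auto simp: levy_measure_def\<close>)

text \<open>The Levy condition makes the dominating function integrable, so an integrand only has to
  be quadratically small near 0 and bounded far away.\<close>

lemma integrable_levy_measure:
  fixes G :: "'a::euclidean_space \<Rightarrow> 'b::{banach, second_countable_topology}"
  assumes "levy_measure \<nu>" and G: "G \<in> borel_measurable borel"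
    and bd: "\<And>u. norm (G u) \<le> C * min 1 ((norm u)\<^sup>2)"
  shows "integrable \<nu> G"
proof (rule Bochner_Integration.integrable_bound)
  have [measurable_cong]: "sets \<nu> = sets borel"
    using assms by (simp add: levy_measure_def)
  show "G \<in> borel_measurable \<nu>" using G by measurable
  show "integrable \<nu> (\<lambda>u. C * min 1 ((norm u)\<^sup>2))"
    using levy_measure_integrable_min[OF assms(1)] by simp
  show "AE u in \<nu>. norm (G u) \<le> norm (C * min 1 ((norm u)\<^sup>2))"
    by (intro AE_I2) (metis abs_ge_self bd order_trans real_norm_def)
qed

lemma norm_cis_minus_1_le: "norm (cis y - 1) \<le> \<bar>y\<bar>"
  using iexp_approx1[of y 0] by (simp add: cis_conv_exp)

lemma norm_cis_minus_1_minus_le: "norm (cis y - 1 - \<i> * of_real y) \<le> y\<^sup>2 / 2"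
  using iexp_approx1[of y 1] by (simp add: cis_conv_exp power2_eq_square algebra_simps)

lemma borel_measurable_cis [measurable]: "cis \<in> borel_measurable borel"
  by (intro borel_measurable_continuous_onI continuous_intros)

lemma borel_measurable_cnj [measurable]: "cnj \<in> borel_measurable borel"
  by (intro borel_measurable_continuous_onI continuous_intros)

text \<open>Each factor is at most linear in \<open>norm u\<close> and at most 2, so the product is
  at most quadratic and at most 4. Adding the two constants serves both branches of
  \<open>min\<close>.\<close>

lemma integrable_cis_gram:
  assumes "levy_measure \<nu>"
  shows "integrable \<nu> (\<lambda>u. (cis (\<xi> \<bullet> u) - 1) * cnj (cis (\<eta> \<bullet> u) - 1))"
proof (rule integrable_levy_measure[OF assms])
  fix u
  have "norm ((cis (\<xi> \<bullet> u) - 1) * cnj (cis (\<eta> \<bullet> u) - 1)) = norm (cis (\<xi> \<bullet> u) - 1) * norm (cis (\<eta> \<bullet> u) - 1)" (is "?n = _")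
    by (simp only: norm_mult complex_mod_cnj)
  moreover have "norm (cis (z \<bullet> u) - 1) \<le> norm z * norm u" for z
    using norm_cis_minus_1_le[of "z \<bullet> u"] Cauchy_Schwarz_ineq2[of z u] by linarith
  moreover have "norm (cis y - 1) \<le> 2" for y
    using norm_triangle_ineq4[of "cis y" 1] by simp
  ultimately have "?n \<le> (norm \<xi> * norm u) * (norm \<eta> * norm u)" "?n \<le> 2 * 2"
    by (simp_all only:) (intro mult_mono; simp)+
  then show "?n \<le> (norm \<xi> * norm \<eta> + 4) * min 1 ((norm u)\<^sup>2)"
    by (auto simp: min_def power2_eq_square algebra_simps intro: order_trans add_increasing add_increasing2)
qed measurable

text \<open>Inside the unit ball the integrand is a second-order Taylor remainder; outside, the
  compensator is absent and only \<open>cis - 1\<close>, of norm at most 2, is left.\<close>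

lemma integrable_levy_khintchine:
  assumes "levy_measure \<nu>"
  shows "integrable \<nu> (\<lambda>u. cis (\<xi> \<bullet> u) - 1 - \<i> * of_real (\<xi> \<bullet> u) * indicator {u. norm u \<le> 1} u)"
proof (rule integrable_levy_measure[OF assms])
  fix u
  show "norm (cis (\<xi> \<bullet> u) - 1 - \<i> * of_real (\<xi> \<bullet> u) * indicator {u. norm u \<le> 1} u)
      \<le> ((norm \<xi>)\<^sup>2 + 2) * min 1 ((norm u)\<^sup>2)"
  proof (cases "norm u \<le> 1")
    case True
    then have m: "min 1 ((norm u)\<^sup>2) = (norm u)\<^sup>2"
      by (simp add: power_le_one)
    have "(\<xi> \<bullet> u)\<^sup>2 \<le> (norm \<xi>)\<^sup>2 * (norm u)\<^sup>2"
      using Cauchy_Schwarz_ineq2[of \<xi> u] by (metis abs_le_square_iff abs_mult abs_norm_cancel power_mult_distrib)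
    moreover have "(\<xi> \<bullet> u)\<^sup>2 / 2 \<le> (\<xi> \<bullet> u)\<^sup>2" by simp
    moreover have "0 \<le> 2 * (norm u)\<^sup>2" by simp
    ultimately have "norm (cis (\<xi> \<bullet> u) - 1 - \<i> * of_real (\<xi> \<bullet> u))
        \<le> (norm \<xi>)\<^sup>2 * (norm u)\<^sup>2 + 2 * (norm u)\<^sup>2"
      using norm_cis_minus_1_minus_le[of "\<xi> \<bullet> u"] by linarith
    then show ?thesis
      using True m by (simp add: distrib_right)
  next
    case False
    then have m: "min 1 ((norm u)\<^sup>2) = 1"
      by simp
    show ?thesis
      using norm_triangle_ineq4[of "cis (\<xi> \<bullet> u)" 1] False m by (simp add: add_increasing)
  qed
qed measurable

text \<open>In the exponents for \<open>\<xi> - \<eta>\<close>, \<open>\<xi>\<close> and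
  \<open>- \<eta>\<close>, drift and compensator are linear in the frequency and cancel. What
  survives is \<open>cis\<close> of the difference, minus the two single terms, plus 1, which is
  exactly the Gram product.\<close>

lemma levy_khintchine_factor:
  fixes X :: "'w \<Rightarrow> 'a::euclidean_space"
  assumes "levy_measure \<nu>" "levy_khintchine M X b \<nu>"
  shows "(\<integral>\<omega>. cis ((\<xi> - \<eta>) \<bullet> X \<omega>) \<partial>M)
    = (\<integral>\<omega>. cis (\<xi> \<bullet> X \<omega>) \<partial>M) * cnj (\<integral>\<omega>. cis (\<eta> \<bullet> X \<omega>) \<partial>M)
      * exp (\<integral>u. (cis (\<xi> \<bullet> u) - 1) * cnj (cis (\<eta> \<bullet> u) - 1) \<partial>\<nu>)"
proof -
  let ?I = "\<lambda>\<xi> u. cis (\<xi> \<bullet> u) - 1 - \<i> * complex_of_real (\<xi> \<bullet> u) * indicator {u. norm u \<le> 1} u"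
  have \<phi>: "(\<integral>\<omega>. cis (\<zeta> \<bullet> X \<omega>) \<partial>M)
      = exp (\<i> * complex_of_real (b \<bullet> \<zeta>) + (\<integral>u. ?I \<zeta> u \<partial>\<nu>))" for \<zeta>
    using assms(2) by (simp add: levy_khintchine_def cis_conv_exp)
  have i: "integrable \<nu> (?I \<zeta>)" for \<zeta>
    by (rule integrable_levy_khintchine[OF assms(1)])
  have "(cis (\<xi> \<bullet> u) - 1) * cnj (cis (\<eta> \<bullet> u) - 1) = ?I (\<xi> - \<eta>) u - ?I \<xi> u - ?I (- \<eta>) u" for u
    by (simp add: algebra_simps cis_cnj cis_mult inner_diff_left)
  then have "(\<integral>u. (cis (\<xi> \<bullet> u) - 1) * cnj (cis (\<eta> \<bullet> u) - 1) \<partial>\<nu>)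
      = (\<integral>u. ?I (\<xi> - \<eta>) u \<partial>\<nu>) - (\<integral>u. ?I \<xi> u \<partial>\<nu>) - (\<integral>u. ?I (- \<eta>) u \<partial>\<nu>)"
    using i by (simp only: Bochner_Integration.integral_diff Bochner_Integration.integrable_diff)
  moreover have "cnj (\<integral>\<omega>. cis (\<eta> \<bullet> X \<omega>) \<partial>M) = (\<integral>\<omega>. cis (- \<eta> \<bullet> X \<omega>) \<partial>M)"
    by (simp only: Bochner_Integration.integral_cnj[symmetric] cis_cnj inner_minus_left)
  ultimately show ?thesis
    unfolding \<phi> by (simp add: inner_diff_right flip: exp_add) (simp add: algebra_simps)
qed

section \<open>The inequality for trigonometric polynomials\<close>

text \<open>Energy, second moment and squared mean are all Hermitian forms in the coefficients
  \<open>a j\<close>, so their combination can be tested against a single matrix. Measurability of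
  the inner integral is recorded because it has to pass to the limit later.\<close>

lemma poincare_trig_polynomial:
  fixes X :: "'w \<Rightarrow> 'a::euclidean_space" and g :: "'a \<Rightarrow> real"
  assumes "prob_space M" and X [measurable]: "X \<in> borel_measurable M"
    and "levy_measure \<nu>" and "levy_khintchine M X b \<nu>"
    and g: "\<And>x. complex_of_real (g x) = (\<Sum>j\<in>J. a j * cis (\<xi> j \<bullet> x))"
  shows "(\<lambda>\<omega>. \<integral>u. (g (X \<omega> + u) - g (X \<omega>))\<^sup>2 \<partial>\<nu>) \<in> borel_measurable M"
    and "(\<integral>\<omega>. (g (X \<omega>))\<^sup>2 \<partial>M) - (\<integral>\<omega>. g (X \<omega>) \<partial>M)\<^sup>2
      \<le> (\<integral>\<omega>. (\<integral>u. (g (X \<omega> + u) - g (X \<omega>))\<^sup>2 \<partial>\<nu>) \<partial>M)"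
proof -
  interpret prob_space M by fact
  define h where "h = (\<lambda>j u. cis (\<xi> j \<bullet> u) - 1)"
  define c where "c = (\<lambda>j l. \<integral>u. h j u * cnj (h l u) \<partial>\<nu>)"
  define \<phi> where "\<phi> = (\<lambda>\<zeta>. \<integral>\<omega>. cis (\<zeta> \<bullet> X \<omega>) \<partial>M)"
  have hint: "integrable \<nu> (\<lambda>u. h j u * cnj (h l u))" for j l
    unfolding h_def by (rule integrable_cis_gram) fact
  have cint: "integrable M (\<lambda>\<omega>. cis (\<zeta> \<bullet> X \<omega>))" for \<zeta>
  proof (rule integrable_const_bound[where B = 1])
    show "(\<lambda>\<omega>. cis (\<zeta> \<bullet> X \<omega>)) \<in> borel_measurable M"
      by measurable
  qed simp
  have sq: "complex_of_real (y\<^sup>2) = z * cnj z" if "complex_of_real y = z" for y z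
    using that by (auto simp: power2_eq_square)
  \<comment> \<open>The increment in direction \<open>u\<close> multiplies the coefficient at
    frequency \<open>\<xi> j\<close> by \<open>h j u\<close>; integrating its squared modulus
    produces the Gram entries \<open>c j l\<close>.\<close>
  have inner: "complex_of_real (\<integral>u. (g (x + u) - g x)\<^sup>2 \<partial>\<nu>)
      = (\<Sum>j\<in>J. \<Sum>l\<in>J. a j * cnj (a l) * c j l * cis ((\<xi> j - \<xi> l) \<bullet> x))" for x
  proof -
    have "complex_of_real (g (x + u) - g x) = (\<Sum>j\<in>J. a j * cis (\<xi> j \<bullet> x) * h j u)" for u
      by (simp add: g h_def inner_add_right algebra_simps sum_subtractf flip: cis_mult)
    from sq[OF this] have "complex_of_real ((g (x + u) - g x)\<^sup>2)
        = (\<Sum>j\<in>J. \<Sum>l\<in>J. (a j * cnj (a l) * cis ((\<xi> j - \<xi> l) \<bullet> x)) * (h j u * cnj (h l u)))" for u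
      by (simp add: sum_product cis_cnj inner_diff_left cis_divide[symmetric] divide_inverse mult_ac)
    then have "(\<integral>u. complex_of_real ((g (x + u) - g x)\<^sup>2) \<partial>\<nu>)
        = (\<Sum>j\<in>J. \<Sum>l\<in>J. (a j * cnj (a l) * cis ((\<xi> j - \<xi> l) \<bullet> x)) * c j l)"
      using hint by (simp add: c_def)
    then show ?thesis by (simp only: integral_complex_of_real) (simp add: mult_ac)
  qed
  show meas: "(\<lambda>\<omega>. \<integral>u. (g (X \<omega> + u) - g (X \<omega>))\<^sup>2 \<partial>\<nu>) \<in> borel_measurable M"
  proof -
    have "(\<lambda>\<omega>. \<integral>u. (g (X \<omega> + u) - g (X \<omega>))\<^sup>2 \<partial>\<nu>)
        = (\<lambda>\<omega>. Re (\<Sum>j\<in>J. \<Sum>l\<in>J. a j * cnj (a l) * c j l * cis ((\<xi> j - \<xi> l) \<bullet> X \<omega>)))"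
      unfolding inner[symmetric] by simp
    then show ?thesis by simp
  qed
  have "complex_of_real (\<integral>\<omega>. (\<integral>u. (g (X \<omega> + u) - g (X \<omega>))\<^sup>2 \<partial>\<nu>) \<partial>M)
      = (\<Sum>j\<in>J. \<Sum>l\<in>J. a j * cnj (a l) * c j l * \<phi> (\<xi> j - \<xi> l))"
  proof -
    have "complex_of_real (\<integral>\<omega>. (\<integral>u. (g (X \<omega> + u) - g (X \<omega>))\<^sup>2 \<partial>\<nu>) \<partial>M)
        = (\<integral>\<omega>. complex_of_real (\<integral>u. (g (X \<omega> + u) - g (X \<omega>))\<^sup>2 \<partial>\<nu>) \<partial>M)"
      by (rule integral_complex_of_real[symmetric])
    then show ?thesis
      unfolding inner \<phi>_def using cint by simp
  qed
  moreover have "complex_of_real (\<integral>\<omega>. (g (X \<omega>))\<^sup>2 \<partial>M)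
      = (\<Sum>j\<in>J. \<Sum>l\<in>J. a j * cnj (a l) * \<phi> (\<xi> j - \<xi> l))"
  proof -
    have "complex_of_real ((g x)\<^sup>2) = (\<Sum>j\<in>J. \<Sum>l\<in>J. a j * cnj (a l) * cis ((\<xi> j - \<xi> l) \<bullet> x))" for x
      using sq[OF g, of x]
      by (simp add: sum_product cis_cnj inner_diff_left cis_divide[symmetric] divide_inverse mult_ac)
    then show ?thesis
      unfolding integral_complex_of_real[symmetric] \<phi>_def using cint by simp
  qed
  moreover have "complex_of_real ((\<integral>\<omega>. g (X \<omega>) \<partial>M)\<^sup>2)
      = (\<Sum>j\<in>J. \<Sum>l\<in>J. a j * cnj (a l) * (\<phi> (\<xi> j) * cnj (\<phi> (\<xi> l))))"
  proof -
    have "complex_of_real (\<integral>\<omega>. g (X \<omega>) \<partial>M) = (\<Sum>j\<in>J. a j * \<phi> (\<xi> j))"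
      unfolding integral_complex_of_real[symmetric] g \<phi>_def using cint by simp
    from sq[OF this] show ?thesis
      by (simp add: sum_product mult_ac)
  qed
  ultimately have "complex_of_real ((\<integral>\<omega>. (\<integral>u. (g (X \<omega> + u) - g (X \<omega>))\<^sup>2 \<partial>\<nu>) \<partial>M)
        - ((\<integral>\<omega>. (g (X \<omega>))\<^sup>2 \<partial>M) - (\<integral>\<omega>. g (X \<omega>) \<partial>M)\<^sup>2))
      = (\<Sum>j\<in>J. \<Sum>l\<in>J. a j * cnj (a l) * c j l * \<phi> (\<xi> j - \<xi> l))
        - ((\<Sum>j\<in>J. \<Sum>l\<in>J. a j * cnj (a l) * \<phi> (\<xi> j - \<xi> l))
        - (\<Sum>j\<in>J. \<Sum>l\<in>J. a j * cnj (a l) * (\<phi> (\<xi> j) * cnj (\<phi> (\<xi> l)))))"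
    by (simp only: of_real_diff)
  \<comment> \<open>After factorisation the values of \<open>\<phi>\<close> are absorbed into the
    coefficients. Of the remaining factor, \<open>c * exp c\<close> comes from the energy,
    \<open>- exp c\<close> from the second moment and \<open>1\<close> from the squared
    mean.\<close>
  also have "\<dots> = (\<Sum>j\<in>J. \<Sum>l\<in>J. (a j * \<phi> (\<xi> j)) * cnj (a l * \<phi> (\<xi> l))
        * (c j l * exp (c j l) - exp (c j l) + 1))"
  proof -
    have "\<phi> (\<xi> j - \<xi> l) = \<phi> (\<xi> j) * cnj (\<phi> (\<xi> l)) * exp (c j l)" for j l
      unfolding \<phi>_def c_def h_def by (rule levy_khintchine_factor) fact+
    then show ?thesis
      by (simp add: algebra_simps sum.distrib flip: sum_subtractf)
  qed
  finally have "(\<integral>\<omega>. (\<integral>u. (g (X \<omega> + u) - g (X \<omega>))\<^sup>2 \<partial>\<nu>) \<partial>M)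
        - ((\<integral>\<omega>. (g (X \<omega>))\<^sup>2 \<partial>M) - (\<integral>\<omega>. g (X \<omega>) \<partial>M)\<^sup>2)
      = Re (\<Sum>j\<in>J. \<Sum>l\<in>J. (a j * \<phi> (\<xi> j)) * cnj (a l * \<phi> (\<xi> l))
        * (c j l * exp (c j l) - exp (c j l) + 1))"
    by (metis Re_complex_of_real)
  also have "\<dots> \<ge> 0"
    unfolding c_def using hint by (rule psd_exp_remainder)
  finally show "(\<integral>\<omega>. (g (X \<omega>))\<^sup>2 \<partial>M) - (\<integral>\<omega>. g (X \<omega>) \<partial>M)\<^sup>2
      \<le> (\<integral>\<omega>. (\<integral>u. (g (X \<omega> + u) - g (X \<omega>))\<^sup>2 \<partial>\<nu>) \<partial>M)"
    by simp
qed

subsection \<open>Lipschitz approximation by trigonometric polynomials\<close>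

text \<open>De Casteljau's recursion for the Bernstein polynomial with coefficients \<open>a 0, \<dots>, a n\<close>.\<close>

primrec bernstein :: "nat \<Rightarrow> (nat \<Rightarrow> real) \<Rightarrow> real \<Rightarrow> real" where
  "bernstein 0 a t = a 0"
| "bernstein (Suc n) a t = (1 - t) * bernstein n a t + t * bernstein n (\<lambda>k. a (Suc k)) t"

lemma bernstein_mono:
  assumes "0 \<le> t" "t \<le> 1" "\<And>k. a k \<le> b k"
  shows "bernstein n a t \<le> bernstein n b t"
  using assms(3)
proof (induction n arbitrary: a b)
  case (Suc n)
  then show ?case
    using assms(1,2) by (auto intro!: add_mono mult_left_mono)
qed simp

lemma bernstein_diff: "bernstein n (\<lambda>k. a k - b k) t = bernstein n a t - bernstein n b t"
proof (induction n arbitrary: a b)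
  case (Suc n)
  show ?case
    unfolding bernstein.simps Suc by (simp add: algebra_simps)
qed simp

text \<open>This is the second moment about \<open>c\<close> of a binomial variable with parameters
  \<open>n\<close> and \<open>t\<close>: squared bias plus variance. The case
  \<open>\<beta> = 0\<close> also gives constants.\<close>

lemma bernstein_quadratic:
  "bernstein n (\<lambda>k. \<alpha> + \<beta> * (real k - c)\<^sup>2) t = \<alpha> + \<beta> * ((real n * t - c)\<^sup>2 + real n * (t * (1 - t)))"
proof (induction n arbitrary: c)
  case (Suc n)
  \<comment> \<open>Shifting the coefficients by one moves the centre to \<open>c - 1\<close>, which
    is why the induction runs over all \<open>c\<close>.\<close>
  have shift: "real (Suc k) - c = real k - (c - 1)" for k
    by simp
  show ?case
    unfolding bernstein.simps shift Suc by (simp add: power2_eq_square algebra_simps)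
qed simp

lemma bernstein_const: "bernstein n (\<lambda>k. c) t = c"
  using bernstein_quadratic[of n c 0 0 t] by simp

lemma bernstein_abs_le:
  assumes "0 \<le> t" "t \<le> 1" "\<And>k. \<bar>a k\<bar> \<le> C"
  shows "\<bar>bernstein n a t\<bar> \<le> C"
proof -
  have "- C \<le> a k" "a k \<le> C" for k
    using assms(3)[of k] by auto
  then show ?thesis
    using bernstein_mono[OF assms(1,2), of "\<lambda>_. - C" a n] bernstein_mono[OF assms(1,2), of a "\<lambda>_. C" n]
    by (simp add: bernstein_const abs_le_iff)
qed

text \<open>Each level of the recursion adds one term \<open>t - s\<close> times a Bernstein
  polynomial of forward differences, hence one further \<open>L\<close>. The factor \<open>n\<close>
  cancels later against a node spacing of order \<open>1 / n\<close>.\<close>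

lemma bernstein_lipschitz:
  assumes s: "0 \<le> s" "s \<le> 1" and t: "0 \<le> t" "t \<le> 1"
    and "\<And>k. \<bar>a (Suc k) - a k\<bar> \<le> L"
  shows "\<bar>bernstein n a t - bernstein n a s\<bar> \<le> real n * L * \<bar>t - s\<bar>"
  using assms(5)
proof (induction n arbitrary: a)
  case (Suc n)
  let ?b = "\<lambda>k. a (Suc k)"
  have "bernstein (Suc n) a t - bernstein (Suc n) a s
      = (1 - t) * (bernstein n a t - bernstein n a s) + t * (bernstein n ?b t - bernstein n ?b s)
        + (t - s) * bernstein n (\<lambda>k. ?b k - a k) s"
    unfolding bernstein_diff by (simp add: algebra_simps)
  also have "\<bar>\<dots>\<bar> \<le> (1 - t) * (real n * L * \<bar>t - s\<bar>) + t * (real n * L * \<bar>t - s\<bar>) + \<bar>t - s\<bar> * L"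
  proof (intro order_trans[OF abs_triangle_ineq] add_mono)
    show "\<bar>(1 - t) * (bernstein n a t - bernstein n a s)\<bar> \<le> (1 - t) * (real n * L * \<bar>t - s\<bar>)"
      using Suc.IH[of a] Suc.prems t by (simp add: abs_mult mult_left_mono)
    show "\<bar>t * (bernstein n ?b t - bernstein n ?b s)\<bar> \<le> t * (real n * L * \<bar>t - s\<bar>)"
      using Suc.IH[of ?b] Suc.prems t by (simp add: abs_mult mult_left_mono)
    show "\<bar>(t - s) * bernstein n (\<lambda>k. ?b k - a k) s\<bar> \<le> \<bar>t - s\<bar> * L"
      using bernstein_abs_le[OF s, of "\<lambda>k. ?b k - a k" L n] Suc.prems
      by (simp add: abs_mult mult_left_mono)
  qed
  also have "\<dots> = real (Suc n) * L * \<bar>t - s\<bar>"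
    by (simp add: algebra_simps)
  finally show ?case .
qed simp

text \<open>A variance argument: the absolute deviation is dominated by a quadratic in
  \<open>k\<close>, whose Bernstein polynomial is known exactly, and positivity transfers the
  bound.\<close>

lemma bernstein_approx:
  assumes t: "0 \<le> t" "t \<le> 1" and "n > 0" and "C \<ge> 0"
    and a: "\<And>k. \<bar>a k - v\<bar> \<le> C * \<bar>real k / real n - t\<bar>"
  shows "\<bar>bernstein n a t - v\<bar> \<le> 2 * C / sqrt (real n)"
proof -
  \<comment> \<open>The split \<open>y \<le> d + y^2 / d\<close> is used with \<open>d\<close> of
    the size of the standard deviation of \<open>k / n\<close>, so that both parts contribute at
    most \<open>C / sqrt n\<close>.\<close>
  let ?d = "1 / sqrt (real n)"
  let ?\<beta> = "C / (real n * sqrt (real n))"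
  have n: "real n > 0" using \<open>n > 0\<close> by simp
  have bd: "\<bar>a k - v\<bar> \<le> C * ?d + ?\<beta> * (real k - real n * t)\<^sup>2" for k
  proof -
    let ?y = "\<bar>real k / real n - t\<bar>"
    have "?y \<le> ?d + sqrt (real n) * ?y\<^sup>2"
    proof (cases "?y \<le> ?d")
      case False
      then have "1 \<le> sqrt (real n) * ?y"
        using n by (simp add: field_simps)
      then have "?y * 1 \<le> ?y * (sqrt (real n) * ?y)"
        by (intro mult_left_mono) auto
      moreover have "0 \<le> ?d" by simp
      ultimately show ?thesis
        unfolding power2_eq_square by (simp only: mult_ac mult_1_right mult_1_left)
    qed (use n in \<open>simp add: add_increasing2\<close>)
    then have "C * ?y \<le> C * (?d + sqrt (real n) * ?y\<^sup>2)"
      using \<open>C \<ge> 0\<close> by (rule mult_left_mono)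
    also have "sqrt (real n) * ?y\<^sup>2 = (real k - real n * t)\<^sup>2 / (real n * sqrt (real n))"
    proof -
      have "real k / real n - t = (real k - real n * t) / real n"
        using n by (simp add: field_simps)
      moreover have "sqrt (real n) / (real n)\<^sup>2 = 1 / (real n * sqrt (real n))"
        using n by (simp add: field_simps power2_eq_square)
      moreover have "sqrt (real n) * ((real k - real n * t) / real n)\<^sup>2
          = (real k - real n * t)\<^sup>2 * (sqrt (real n) / (real n)\<^sup>2)"
        by (simp add: power_divide)
      ultimately show ?thesis
        by (simp only: power2_abs) simp
    qed
    finally show ?thesis
      using a[of k] by (simp add: algebra_simps)
  qed
  \<comment> \<open>Centring the quadratic at \<open>n * t\<close> removes the bias and leaves only
    the variance, where \<open>t * (1 - t)\<close> is bounded by 1.\<close>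
  have e: "C * ?d + ?\<beta> * ((real n * t - real n * t)\<^sup>2 + real n * (t * (1 - t))) \<le> 2 * C / sqrt (real n)"
  proof -
    have "t * (1 - t) \<le> 1 * 1" using t by (intro mult_mono) auto
    then have "?\<beta> * (real n * (t * (1 - t))) \<le> ?\<beta> * (real n * 1)"
      using \<open>C \<ge> 0\<close> by (intro mult_left_mono) auto
    then show ?thesis using n by simp
  qed
  have "bernstein n (\<lambda>k. a k - v) t \<le> bernstein n (\<lambda>k. C * ?d + ?\<beta> * (real k - real n * t)\<^sup>2) t"
    by (rule bernstein_mono[OF t]) (use bd in \<open>simp add: abs_le_iff\<close>)
  moreover have "bernstein n (\<lambda>k. v - a k) t \<le> bernstein n (\<lambda>k. C * ?d + ?\<beta> * (real k - real n * t)\<^sup>2) t"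
    by (rule bernstein_mono[OF t]) (use bd in \<open>simp add: abs_le_iff\<close>)
  ultimately show ?thesis
    using e unfolding bernstein_quadratic bernstein_diff bernstein_const by linarith
qed

section \<open>One-coordinate Bernstein operators in a sine variable\<close>

text \<open>Only steps along basis vectors are controlled: in this form the constant
  \<open>L\<close> survives unchanged under operators acting on one coordinate at a time.\<close>

definition coord_lipschitz :: "real \<Rightarrow> ('a::euclidean_space \<Rightarrow> real) \<Rightarrow> bool" where
  "coord_lipschitz L g \<longleftrightarrow> (\<forall>x c. \<forall>i\<in>Basis. \<bar>g (x + c *\<^sub>R i) - g x\<bar> \<le> L * \<bar>c\<bar>)"

lemma coord_lipschitzD:
  "coord_lipschitz L g \<Longrightarrow> i \<in> Basis \<Longrightarrow> \<bar>g (x + c *\<^sub>R i) - g x\<bar> \<le> L * \<bar>c\<bar>"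
  by (simp add: coord_lipschitz_def)

text \<open>The path from \<open>x\<close> to \<open>x + u\<close> changes one coordinate at a time,
  and each step has length at most \<open>norm u\<close>.\<close>

lemma coord_lipschitzD_norm:
  fixes g :: "'a::euclidean_space \<Rightarrow> real"
  assumes "coord_lipschitz L g" "L \<ge> 0"
  shows "\<bar>g (x + u) - g x\<bar> \<le> L * real DIM('a) * norm u"
proof -
  have "\<bar>g (x + (\<Sum>i\<in>S. (u \<bullet> i) *\<^sub>R i)) - g x\<bar> \<le> L * real (card S) * norm u" if "S \<subseteq> Basis" for S
    using finite_subset[OF that finite_Basis] that
  proof (induction S rule: finite_induct)
    case (insert i S)
    let ?y = "x + (\<Sum>i\<in>S. (u \<bullet> i) *\<^sub>R i)"
    have "\<bar>g (?y + (u \<bullet> i) *\<^sub>R i) - g ?y\<bar> \<le> L * \<bar>u \<bullet> i\<bar>"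
      using assms insert.prems by (intro coord_lipschitzD) auto
    also have "\<dots> \<le> L * norm u"
      using assms insert.prems by (intro mult_left_mono Basis_le_norm) auto
    finally show ?case
      using insert by (simp add: algebra_simps)
  qed simp
  from this[of Basis] show ?thesis
    by (simp add: euclidean_representation)
qed

text \<open>Coordinate \<open>i\<close> is sampled at equally spaced nodes of
  \<open>[-T, T]\<close>. The parameter \<open>t = (1 + sin (x \<bullet> i / T)) / 2\<close>
  corresponds to the position \<open>T * (2 * t - 1) = T * sin (x \<bullet> i / T)\<close>, close to
  \<open>x \<bullet> i\<close> for large \<open>T\<close>.\<close>

definition coord_bernstein :: "real \<Rightarrow> nat \<Rightarrow> 'a \<Rightarrow> ('a::euclidean_space \<Rightarrow> real) \<Rightarrow> 'a \<Rightarrow> real" where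
  "coord_bernstein T n i g x =
     bernstein n (\<lambda>k. g (x + (T * (2 * real k / real n - 1) - x \<bullet> i) *\<^sub>R i)) ((1 + sin (x \<bullet> i / T)) / 2)"

lemma sin_unit_bounds: "0 \<le> (1 + sin y) / 2" "(1 + sin (y::real)) / 2 \<le> 1"
  using sin_ge_minus_one[of y] sin_le_one[of y] by (simp_all del: sin_ge_minus_one sin_le_one)

lemma coord_bernstein_bounded:
  assumes "\<And>x. \<bar>g x\<bar> \<le> K"
  shows "\<bar>coord_bernstein T n i g x\<bar> \<le> K"
  unfolding coord_bernstein_def by (intro bernstein_abs_le sin_unit_bounds assms)

lemma abs_sin_diff_le: "\<bar>sin x - sin y\<bar> \<le> \<bar>x - (y::real)\<bar>"
proof -
  have "norm (sin x - sin y) \<le> 1 * norm (x - y)"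
    by (rule differentiable_bound[where S = UNIV and f' = "\<lambda>x h. cos x * h"])
      (auto intro!: derivative_eq_intros onorm_bound simp: abs_mult mult_left_le_one_le)
  then show ?thesis by simp
qed

text \<open>Along \<open>i\<close> the factors are \<open>n\<close> from the Bernstein bound,
  \<open>2 * T / n\<close> from the node spacing, \<open>1 / 2\<close> from the parameter and
  \<open>1 / T\<close> from the sine; their product is 1. Along other directions the increment is a
  Bernstein average of increments of \<open>g\<close>.\<close>

lemma coord_bernstein_lipschitz:
  assumes lip: "coord_lipschitz L g" and i: "i \<in> Basis" and "T > 0" "n > 0"
  shows "coord_lipschitz L (coord_bernstein T n i g)"
  unfolding coord_lipschitz_def
proof (intro allI ballI)
  fix x :: 'a and c j assume j: "j \<in> (Basis :: 'a set)"
  let ?p = "\<lambda>x k. x + (T * (2 * real k / real n - 1) - x \<bullet> i) *\<^sub>R i"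
  show "\<bar>coord_bernstein T n i g (x + c *\<^sub>R j) - coord_bernstein T n i g x\<bar> \<le> L * \<bar>c\<bar>"
  proof (cases "j = i")
    case True
    let ?s = "(1 + sin (x \<bullet> i / T)) / 2" and ?t = "(1 + sin ((x \<bullet> i + c) / T)) / 2"
    \<comment> \<open>The sample points do not depend on coordinate \<open>i\<close> of
      \<open>x\<close>, so only the parameter moves.\<close>
    have p: "?p (x + c *\<^sub>R i) k = ?p x k" for k
      using i by (simp add: inner_add_left algebra_simps)
    have st: "coord_bernstein T n i g x = bernstein n (\<lambda>k. g (?p x k)) ?s"
      "coord_bernstein T n i g (x + c *\<^sub>R j) = bernstein n (\<lambda>k. g (?p x k)) ?t"
      unfolding coord_bernstein_def True p using i by (simp_all add: inner_add_left)
    have step: "\<bar>g (?p x (Suc k)) - g (?p x k)\<bar> \<le> L * (2 * T / real n)" for k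
    proof -
      have "?p x (Suc k) = ?p x k + (2 * T / real n) *\<^sub>R i"
        using \<open>n > 0\<close> by (simp add: field_simps flip: scaleR_add_left)
      then have "\<bar>g (?p x (Suc k)) - g (?p x k)\<bar> \<le> L * \<bar>2 * T / real n\<bar>"
        using coord_lipschitzD[OF lip i] by metis
      then show ?thesis using \<open>T > 0\<close> by simp
    qed
    have "\<bar>bernstein n (\<lambda>k. g (?p x k)) ?t - bernstein n (\<lambda>k. g (?p x k)) ?s\<bar>
        \<le> real n * (L * (2 * T / real n)) * \<bar>?t - ?s\<bar>"
      by (intro bernstein_lipschitz sin_unit_bounds step)
    also have "\<dots> = L * T * \<bar>sin ((x \<bullet> i + c) / T) - sin (x \<bullet> i / T)\<bar>"
    proof -
      have "?t - ?s = (sin ((x \<bullet> i + c) / T) - sin (x \<bullet> i / T)) / 2"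
        by (simp add: field_simps)
      then show ?thesis
        using \<open>n > 0\<close> by (simp only: abs_divide) simp
    qed
    also have "\<dots> \<le> L * T * \<bar>(x \<bullet> i + c) / T - x \<bullet> i / T\<bar>"
    proof (intro mult_left_mono abs_sin_diff_le)
      \<comment> \<open>The Lipschitz bound with \<open>c = 1\<close> forces \<open>L\<close> to be
        nonnegative.\<close>
      have "0 \<le> L * \<bar>1\<bar>" using coord_lipschitzD[OF lip i, of x 1] by linarith
      then show "0 \<le> L * T" using \<open>T > 0\<close> by simp
    qed
    also have "\<dots> = L * \<bar>c\<bar>"
      using \<open>T > 0\<close> by (simp add: field_simps)
    finally show ?thesis unfolding st .
  next
    case False
    then have [simp]: "j \<bullet> i = 0" using i j by (simp add: inner_not_same_Basis)
    have "?p (x + c *\<^sub>R j) k = ?p x k + c *\<^sub>R j" for k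
      by (simp add: inner_add_left algebra_simps)
    then have "coord_bernstein T n i g (x + c *\<^sub>R j) - coord_bernstein T n i g x
        = bernstein n (\<lambda>k. g (?p x k + c *\<^sub>R j) - g (?p x k)) ((1 + sin (x \<bullet> i / T)) / 2)"
      unfolding coord_bernstein_def bernstein_diff by (simp add: inner_add_left add_ac)
    then show ?thesis
      by (simp only:) (intro bernstein_abs_le sin_unit_bounds coord_lipschitzD[OF lip j])
  qed
qed

text \<open>The error splits at the point \<open>?v\<close>, where coordinate \<open>i\<close> is
  replaced by \<open>T * sin (x \<bullet> i / T)\<close>: the Bernstein error there, then the
  Lipschitz cost of returning to \<open>x\<close>.\<close>

lemma coord_bernstein_approx:
  assumes lip: "coord_lipschitz L g" and i: "i \<in> Basis" and "L \<ge> 0" "T > 0" "n > 0"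
  shows "\<bar>coord_bernstein T n i g x - g x\<bar> \<le> 4 * L * T / sqrt (real n) + L * \<bar>T * sin (x \<bullet> i / T) - x \<bullet> i\<bar>"
proof -
  let ?t = "(1 + sin (x \<bullet> i / T)) / 2"
  let ?v = "x + (T * sin (x \<bullet> i / T) - x \<bullet> i) *\<^sub>R i"
  have "\<bar>coord_bernstein T n i g x - g ?v\<bar> \<le> 2 * (2 * L * T) / sqrt (real n)"
    unfolding coord_bernstein_def
  proof (intro bernstein_approx sin_unit_bounds \<open>n > 0\<close>)
    show "0 \<le> 2 * L * T" using \<open>L \<ge> 0\<close> \<open>T > 0\<close> by simp
    fix k
    let ?w = "x + (T * (2 * real k / real n - 1) - x \<bullet> i) *\<^sub>R i"
    have "?w = ?v + (2 * T * (real k / real n - ?t)) *\<^sub>R i"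
      by (simp add: algebra_simps add_divide_distrib flip: scaleR_add_left)
    then have "\<bar>g ?w - g ?v\<bar> \<le> L * \<bar>2 * T * (real k / real n - ?t)\<bar>"
      using coord_lipschitzD[OF lip i] by metis
    then show "\<bar>g ?w - g ?v\<bar> \<le> 2 * L * T * \<bar>real k / real n - ?t\<bar>"
      using \<open>T > 0\<close> by (simp only: abs_mult) (simp add: mult_ac)
  qed
  moreover have "\<bar>g ?v - g x\<bar> \<le> L * \<bar>T * sin (x \<bullet> i / T) - x \<bullet> i\<bar>"
    by (rule coord_lipschitzD[OF lip i])
  ultimately show ?thesis by simp
qed

section \<open>Iteration over the coordinates and expansion in exponentials\<close>

text \<open>Functions that are trigonometric polynomials in the coordinates of \<open>S\<close>, with coefficients
  depending on the remaining coordinates.\<close>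

inductive trig_in :: "'a::euclidean_space set \<Rightarrow> ('a \<Rightarrow> real) \<Rightarrow> bool" for S where
  indep: "(\<And>x c i. i \<in> S \<Longrightarrow> h (x + c *\<^sub>R i) = h x) \<Longrightarrow> trig_in S h"
| sin: "i \<in> Basis \<Longrightarrow> trig_in S (\<lambda>x. sin (r * (x \<bullet> i)))"
| add: "trig_in S g \<Longrightarrow> trig_in S h \<Longrightarrow> trig_in S (\<lambda>x. g x + h x)"
| mult: "trig_in S g \<Longrightarrow> trig_in S h \<Longrightarrow> trig_in S (\<lambda>x. g x * h x)"

lemma trig_in_const: "trig_in S (\<lambda>x. c)"
  by (rule trig_in.indep) simp

text \<open>Freezing coordinate \<open>i\<close> at \<open>c\<close> removes all dependence on it,
  so \<open>i\<close> may join \<open>S\<close>. The samples in \<open>coord_bernstein\<close> have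
  this form.\<close>

lemma trig_in_subst:
  assumes "trig_in S g" and i: "i \<in> Basis" and "S \<subseteq> Basis"
  shows "trig_in (insert i S) (\<lambda>x. g (x + (c - x \<bullet> i) *\<^sub>R i))"
  using assms(1)
proof induction
  case (indep h)
  show ?case
  proof (rule trig_in.indep)
    fix x d j assume j: "j \<in> insert i S"
    show "h (x + d *\<^sub>R j + (c - (x + d *\<^sub>R j) \<bullet> i) *\<^sub>R i) = h (x + (c - x \<bullet> i) *\<^sub>R i)"
    proof (cases "j = i")
      case True
      then show ?thesis using i by (simp add: inner_add_left algebra_simps)
    next
      case False
      then have "j \<in> S" "j \<bullet> i = 0"
        using i j \<open>S \<subseteq> Basis\<close> by (auto intro: inner_not_same_Basis)
      then show ?thesis
        using indep[of j "x + (c - x \<bullet> i) *\<^sub>R i" d] by (simp add: inner_add_left algebra_simps)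
    qed
  qed
next
  case (sin j r)
  show ?case
  proof (cases "j = i")
    case True
    then show ?thesis using i by (simp add: inner_add_left trig_in_const)
  next
    case False
    then have "i \<bullet> j = 0" using i sin by (intro inner_not_same_Basis) auto
    then show ?thesis using trig_in.sin[OF sin] by (simp add: inner_add_left)
  qed
qed (auto intro: trig_in.add trig_in.mult)

lemma trig_in_bernstein:
  assumes "\<And>k. trig_in S (a k)" "trig_in S t"
  shows "trig_in S (\<lambda>x. bernstein n (\<lambda>k. a k x) (t x))"
  using assms(1)
proof (induction n arbitrary: a)
  case (Suc n)
  have "trig_in S (\<lambda>x. (1 + (- 1) * t x) * bernstein n (\<lambda>k. a k x) (t x)
      + t x * bernstein n (\<lambda>k. a (Suc k) x) (t x))"
    by (intro trig_in.add trig_in.mult trig_in_const assms(2) Suc)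
  then show ?case by simp
qed simp

lemma trig_in_coord_bernstein:
  assumes "trig_in S g" and i: "i \<in> Basis" and "S \<subseteq> Basis"
  shows "trig_in (insert i S) (coord_bernstein T n i g)"
proof -
  have "trig_in (insert i S) (\<lambda>x. 1 / 2 + 1 / 2 * sin (1 / T * (x \<bullet> i)))"
    by (intro trig_in.add trig_in.mult trig_in_const trig_in.sin i)
  then have "trig_in (insert i S) (\<lambda>x. (1 + sin (x \<bullet> i / T)) / 2)"
    by (simp add: add_divide_distrib)
  then show ?thesis
    unfolding coord_bernstein_def[abs_def] by (intro trig_in_bernstein trig_in_subst assms)
qed

text \<open>The operators are applied one coordinate after another. Since \<open>K\<close> and
  \<open>L\<close> never grow, every step can use the same error estimate.\<close>

lemma trig_in_approx:
  fixes f :: "'a::euclidean_space \<Rightarrow> real"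
  assumes bd: "\<And>x. \<bar>f x\<bar> \<le> K" and lip: "coord_lipschitz L f" and "L \<ge> 0" "T > 0" "\<epsilon> > 0"
    and "S \<subseteq> Basis"
  shows "\<exists>p. trig_in S p \<and> (\<forall>x. \<bar>p x\<bar> \<le> K) \<and> coord_lipschitz L p
    \<and> (\<forall>x. \<bar>p x - f x\<bar> \<le> \<epsilon> + L * (\<Sum>i\<in>S. \<bar>T * sin (x \<bullet> i / T) - x \<bullet> i\<bar>))"
  using finite_subset[OF \<open>S \<subseteq> Basis\<close> finite_Basis] \<open>S \<subseteq> Basis\<close> \<open>\<epsilon> > 0\<close>
proof (induction S arbitrary: \<epsilon> rule: finite_induct)
  case empty
  have "trig_in {} f" by (rule trig_in.indep) simp
  then show ?case using bd lip empty by (intro exI[of _ f]) auto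
next
  case (insert i S)
  \<comment> \<open>Half of \<open>\<epsilon>\<close> goes to the earlier coordinates; the degree
    \<open>n\<close> is then chosen so that the new Bernstein error fits into the other
    half.\<close>
  from insert.IH[of "\<epsilon> / 2"] insert.prems
  obtain p where p: "trig_in S p" "\<And>x. \<bar>p x\<bar> \<le> K" "coord_lipschitz L p"
    "\<And>x. \<bar>p x - f x\<bar> \<le> \<epsilon> / 2 + L * (\<Sum>i\<in>S. \<bar>T * sin (x \<bullet> i / T) - x \<bullet> i\<bar>)"
    by auto
  have i: "i \<in> Basis" "S \<subseteq> Basis" using insert by auto
  have "(\<lambda>n. 4 * L * T / sqrt (real n)) \<longlonglongrightarrow> 0"
    by (intro tendsto_divide_0[OF tendsto_const] filterlim_at_top_imp_at_infinity
        filterlim_compose[OF sqrt_at_top filterlim_real_sequentially])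
  then have "\<forall>\<^sub>F n in sequentially. 4 * L * T / sqrt (real n) < \<epsilon> / 2"
    using insert.prems by (intro order_tendstoD(2)[of _ 0]) auto
  then obtain n where n: "n > 0" "4 * L * T / sqrt (real n) < \<epsilon> / 2"
    by (metis (mono_tags, lifting) eventually_conj eventually_gt_at_top eventually_happens' sequentially_bot)
  let ?q = "coord_bernstein T n i p"
  have "\<bar>?q x - f x\<bar> \<le> \<epsilon> + L * (\<Sum>i\<in>insert i S. \<bar>T * sin (x \<bullet> i / T) - x \<bullet> i\<bar>)" for x
  proof -
    have "L * (\<Sum>i\<in>insert i S. \<bar>T * sin (x \<bullet> i / T) - x \<bullet> i\<bar>)
        = L * \<bar>T * sin (x \<bullet> i / T) - x \<bullet> i\<bar> + L * (\<Sum>i\<in>S. \<bar>T * sin (x \<bullet> i / T) - x \<bullet> i\<bar>)"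
      using insert.hyps by (simp add: algebra_simps)
    then show ?thesis
      using p(4)[of x] n(2) coord_bernstein_approx[OF p(3) i(1) \<open>L \<ge> 0\<close> \<open>T > 0\<close> n(1), of x] by linarith
  qed
  moreover have "trig_in (insert i S) ?q"
    by (intro trig_in_coord_bernstein p i)
  moreover have "coord_lipschitz L ?q"
    by (intro coord_bernstein_lipschitz p i n \<open>T > 0\<close>)
  moreover have "\<bar>?q x\<bar> \<le> K" for x
    by (intro coord_bernstein_bounded p)
  ultimately show ?case by blast
qed

text \<open>A function independent of every coordinate is constant. Lists admit repeated
  frequencies, so sums become concatenations and products become lists of pairwise products with
  added frequencies.\<close>

lemma trig_in_Basis_expansion:
  fixes g :: "'a::euclidean_space \<Rightarrow> real"
  assumes "trig_in Basis g"
  shows "\<exists>xs. \<forall>x. complex_of_real (g x) = (\<Sum>(a, \<xi>)\<leftarrow>xs. a * cis (\<xi> \<bullet> x))"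
  using assms
proof induction
  case (indep h)
  have "h x = h 0" for x
  proof -
    have "h (\<Sum>i\<in>S. (x \<bullet> i) *\<^sub>R i) = h 0" if "S \<subseteq> Basis" for S
      using finite_subset[OF that finite_Basis] that
    proof (induction S rule: finite_induct)
      case (insert i S)
      then show ?case
        using indep[of i "\<Sum>i\<in>S. (x \<bullet> i) *\<^sub>R i" "x \<bullet> i"] by (simp add: add.commute)
    qed simp
    from this[of Basis] show ?thesis by (simp add: euclidean_representation)
  qed
  note const = this
  have "complex_of_real (h x) = (\<Sum>(a, \<xi>)\<leftarrow>[(complex_of_real (h 0), 0 :: 'a)]. a * cis (\<xi> \<bullet> x))" for x
    unfolding const[of x] by simp
  then show ?case by blast
next
  case (sin i r)
  have "complex_of_real (sin (r * (x \<bullet> i)))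
      = (\<Sum>(a, \<xi>)\<leftarrow>[(- \<i> / 2, r *\<^sub>R i), (\<i> / 2, - (r *\<^sub>R i))]. a * cis (\<xi> \<bullet> x))" for x
    by (simp add: complex_eq_iff inner_commute)
  then show ?case by blast
next
  case (add g h)
  then obtain xs ys where "\<forall>x. complex_of_real (g x) = (\<Sum>(a, \<xi>)\<leftarrow>xs. a * cis (\<xi> \<bullet> x))"
    "\<forall>x. complex_of_real (h x) = (\<Sum>(a, \<xi>)\<leftarrow>ys. a * cis (\<xi> \<bullet> x))" by blast
  then show ?case by (intro exI[of _ "xs @ ys"]) simp
next
  case (mult g h)
  then obtain xs ys where xy: "\<And>x. complex_of_real (g x) = (\<Sum>(a, \<xi>)\<leftarrow>xs. a * cis (\<xi> \<bullet> x))"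
    "\<And>x. complex_of_real (h x) = (\<Sum>(a, \<xi>)\<leftarrow>ys. a * cis (\<xi> \<bullet> x))" by blast
  have 1: "a * cis (\<xi> \<bullet> x) * (\<Sum>(b, \<eta>)\<leftarrow>ys. b * cis (\<eta> \<bullet> x))
      = (\<Sum>(b, \<eta>)\<leftarrow>map (\<lambda>(b, \<eta>). (a * b, \<xi> + \<eta>)) ys. b * cis (\<eta> \<bullet> x))" for a \<xi> x
    by (induction ys) (auto simp: algebra_simps inner_add_left cis_mult[symmetric])
  have "(\<Sum>(a, \<xi>)\<leftarrow>xs. a * cis (\<xi> \<bullet> x)) * (\<Sum>(b, \<eta>)\<leftarrow>ys. b * cis (\<eta> \<bullet> x))
      = (\<Sum>(a, \<xi>)\<leftarrow>concat (map (\<lambda>(a, \<xi>). map (\<lambda>(b, \<eta>). (a * b, \<xi> + \<eta>)) ys) xs). a * cis (\<xi> \<bullet> x))" for x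
    by (induction xs) (auto simp: distrib_right 1)
  then show ?case
    unfolding of_real_mult xy by blast
qed

section \<open>Test functions and passage to the limit\<close>

text \<open>The function and its directional derivatives are continuous and vanish off a compact
  set, hence are bounded; the mean value inequality along coordinate lines gives
  \<open>L\<close>.\<close>

lemma Cc_infinity_bounds:
  fixes f :: "'a::euclidean_space \<Rightarrow> real"
  assumes "f \<in> Cc_infinity"
  obtains K L where "\<And>x. \<bar>f x\<bar> \<le> K" "L \<ge> 0" "coord_lipschitz L f"
proof -
  let ?S = "closure {x. f x \<noteq> 0}"
  have S: "compact ?S" and C: "C_k 0 f" "C_k (Suc 0) f"
    using assms unfolding Cc_infinity_def by blast+
  have bound: "\<exists>B\<ge>0. \<forall>x. \<bar>g x\<bar> \<le> B" if "continuous_on UNIV g" "\<And>x. x \<notin> ?S \<Longrightarrow> g x = 0" for g :: "'a \<Rightarrow> real"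
  proof -
    have "compact (g ` ?S)"
      using S that(1) by (intro compact_continuous_image) (auto intro: continuous_on_subset)
    then obtain B where B: "B > 0" "\<forall>y\<in>g ` ?S. norm y \<le> B"
      by (meson bounded_pos compact_imp_bounded)
    have "\<bar>g x\<bar> \<le> B" for x
      using B that(2)[of x] by (cases "x \<in> ?S") auto
    with B(1) show ?thesis by (intro exI[of _ B]) auto
  qed
  have out: "f x = 0" if "x \<notin> ?S" for x
    using that closure_subset[of "{x. f x \<noteq> 0}"] by auto
  have "continuous_on UNIV f" using C(1) by simp
  from bound[OF this out] obtain K where K: "\<forall>x. \<bar>f x\<bar> \<le> K"
    by blast
  obtain f' where f': "\<And>x. (f has_derivative f' x) (at x)" and c: "\<And>h. continuous_on UNIV (\<lambda>x. f' x h)"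
    using C(2) unfolding C_k.simps by blast
  have zero: "f' x h = 0" if "x \<notin> ?S" for x h
  proof -
    have "((\<lambda>x. 0) has_derivative f' x) (at x)"
    proof (rule has_derivative_transform_within_open)
      show "(f has_derivative f' x) (at x)" by (rule f')
      show "open (- ?S)" by (intro open_Compl closed_closure)
      show "x \<in> - ?S" using that by (simp only: Compl_iff not_False_eq_True)
      show "f y = 0" if "y \<in> - ?S" for y using that by (intro out) (simp only: Compl_iff not_False_eq_True)
    qed
    then have "f' x = (\<lambda>h. 0)"
      by (rule has_derivative_unique) (rule has_derivative_const)
    then show ?thesis by simp
  qed
  have "\<forall>h. \<exists>B\<ge>0. \<forall>x. \<bar>f' x h\<bar> \<le> B"
    by (intro allI bound c zero)
  then obtain B where B: "\<And>h. B h \<ge> 0" "\<And>x h. \<bar>f' x h\<bar> \<le> B h" by metis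
  \<comment> \<open>The sum dominates each \<open>B i\<close>, giving one constant for all
    coordinates.\<close>
  let ?L = "\<Sum>i\<in>Basis. B i"
  have "coord_lipschitz ?L f"
    unfolding coord_lipschitz_def
  proof (intro allI ballI)
    fix x :: 'a and c i assume i: "i \<in> (Basis :: 'a set)"
    have "B i \<le> ?L" using B(1) i by (intro member_le_sum) auto
    have lin: "f' y (t *\<^sub>R i) = t * f' y i" for y t
      using linear_cmul[OF has_derivative_linear[OF f'[of y]]] by simp
    have "norm (f (x + c *\<^sub>R i) - f (x + 0 *\<^sub>R i)) \<le> ?L * norm (c - 0)"
    proof (rule differentiable_bound[where S = UNIV and f = "\<lambda>t. f (x + t *\<^sub>R i)" and f' = "\<lambda>t s. f' (x + t *\<^sub>R i) (s *\<^sub>R i)"])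
      fix t :: real
      show "((\<lambda>t. f (x + t *\<^sub>R i)) has_derivative (\<lambda>s. f' (x + t *\<^sub>R i) (s *\<^sub>R i))) (at t within UNIV)"
        by (rule has_derivative_compose[OF _ f']) (auto intro!: derivative_eq_intros)
      show "onorm (\<lambda>s. f' (x + t *\<^sub>R i) (s *\<^sub>R i)) \<le> ?L"
      proof (rule onorm_bound)
        fix s :: real
        have "\<bar>f' (x + t *\<^sub>R i) i\<bar> \<le> ?L" using B(2) \<open>B i \<le> ?L\<close> order_trans by blast
        then show "norm (f' (x + t *\<^sub>R i) (s *\<^sub>R i)) \<le> ?L * norm s"
          unfolding lin by (simp add: abs_mult mult_left_mono mult.commute[of "\<bar>s\<bar>"] mult_right_mono)
      qed (use B in \<open>auto intro: sum_nonneg\<close>)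
    qed auto
    then show "\<bar>f (x + c *\<^sub>R i) - f x\<bar> \<le> ?L * \<bar>c\<bar>" by simp
  qed
  moreover have "?L \<ge> 0" by (intro sum_nonneg B(1))
  ultimately show thesis using that[of K ?L] K by simp
qed

lemma coord_lipschitz_continuous_on:
  fixes g :: "'a::euclidean_space \<Rightarrow> real"
  assumes "coord_lipschitz L g" "L \<ge> 0"
  shows "continuous_on A g"
proof (rule lipschitz_on_continuous_on, rule lipschitz_onI)
  show "dist (g x) (g y) \<le> L * real DIM('a) * dist x y" for x y
    using coord_lipschitzD_norm[OF assms, of y "x - y"] by (simp add: dist_norm)
qed (use assms in simp)

text \<open>The limit is the derivative at 0 of \<open>sin (h * y)\<close> in \<open>h\<close>,
  taken along \<open>h = 1 / Suc m\<close>.\<close>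

lemma tendsto_mult_sin_over: "(\<lambda>m. real (Suc m) * sin (y / real (Suc m))) \<longlonglongrightarrow> y"
proof -
  have "((\<lambda>h. sin (h * y)) has_real_derivative y) (at 0)"
    by (auto intro!: derivative_eq_intros)
  from DERIV_D[OF this] have "((\<lambda>h. sin (h * y) / h) \<longlongrightarrow> y) (at 0)"
    by simp
  moreover have "filterlim (\<lambda>m. inverse (real (Suc m))) (at 0) sequentially"
    by (intro filterlim_atI LIMSEQ_inverse_real_of_nat) auto
  ultimately have "(\<lambda>m. sin (inverse (real (Suc m)) * y) / inverse (real (Suc m))) \<longlonglongrightarrow> y"
    by (rule filterlim_compose)
  then show ?thesis
    by (simp add: divide_inverse mult.commute del: of_nat_Suc)
qed

text \<open>The choice is \<open>T = Suc m\<close> and \<open>\<epsilon> = 1 / Suc m\<close>. The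
  error bound tends to 0 at each point, while the bounds \<open>K\<close> and \<open>L\<close>,
  uniform in \<open>m\<close>, prepare dominated convergence.\<close>

lemma trig_polynomial_pointwise_approx:
  fixes f :: "'a::euclidean_space \<Rightarrow> real"
  assumes "\<And>x. \<bar>f x\<bar> \<le> K" "coord_lipschitz L f" "L \<ge> 0"
  obtains p where "\<And>m::nat. trig_in Basis (p m)" "\<And>m x. \<bar>p m x\<bar> \<le> K" "\<And>m. coord_lipschitz L (p m)"
    "\<And>x. (\<lambda>m. p m x) \<longlonglongrightarrow> f x"
proof -
  let ?r = "\<lambda>m x. 1 / real (Suc m)
    + L * (\<Sum>i\<in>Basis. \<bar>real (Suc m) * sin (x \<bullet> i / real (Suc m)) - x \<bullet> i\<bar>)"
  have "\<forall>m. \<exists>p. trig_in Basis p \<and> (\<forall>x. \<bar>p x\<bar> \<le> K) \<and> coord_lipschitz L p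
      \<and> (\<forall>x. \<bar>p x - f x\<bar> \<le> ?r m x)"
    by (intro allI trig_in_approx assms order_refl) simp_all
  from choice[OF this] obtain p where "\<forall>m. trig_in Basis (p m) \<and> (\<forall>x. \<bar>p m x\<bar> \<le> K)
      \<and> coord_lipschitz L (p m) \<and> (\<forall>x. \<bar>p m x - f x\<bar> \<le> ?r m x)" ..
  then have p: "\<And>m. trig_in Basis (p m)" "\<And>m x. \<bar>p m x\<bar> \<le> K"
    "\<And>m. coord_lipschitz L (p m)" "\<And>m x. \<bar>p m x - f x\<bar> \<le> ?r m x"
    by blast+
  have "(\<lambda>m. p m x) \<longlonglongrightarrow> f x" for x
  proof (rule Lim_transform2)
    have "(\<lambda>m. ?r m x) \<longlonglongrightarrow> 0 + L * (\<Sum>i\<in>(Basis :: 'a set). \<bar>x \<bullet> i - x \<bullet> i\<bar>)"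
      unfolding divide_inverse[of 1] mult_1_left
      by (intro tendsto_intros LIMSEQ_inverse_real_of_nat tendsto_mult_sin_over)
    then have "(\<lambda>m. ?r m x) \<longlonglongrightarrow> 0" by simp
    moreover have "\<forall>\<^sub>F m in sequentially. norm (f x - p m x) \<le> ?r m x"
      unfolding real_norm_def abs_minus_commute[of "f x"] by (intro always_eventually allI p(4))
    ultimately show "(\<lambda>m. f x - p m x) \<longlonglongrightarrow> 0"
      by (rule Lim_null_comparison[rotated])
  qed (rule tendsto_const)
  with p show thesis by (intro that[of p])
qed

lemma poincare_levy_khintchine:
  fixes X :: "'w \<Rightarrow> 'a::euclidean_space" and f :: "'a \<Rightarrow> real"
  assumes "prob_space M" and X [measurable]: "X \<in> borel_measurable M"
    and levy: "levy_measure \<nu>" and "levy_khintchine M X b \<nu>"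
    and bd: "\<And>x. \<bar>f x\<bar> \<le> K" and lip: "coord_lipschitz L f" and "L \<ge> 0"
  shows "(\<integral>\<omega>. (f (X \<omega>))\<^sup>2 \<partial>M) - (\<integral>\<omega>. f (X \<omega>) \<partial>M)\<^sup>2
    \<le> (\<integral>\<omega>. (\<integral>u. (f (X \<omega> + u) - f (X \<omega>))\<^sup>2 \<partial>\<nu>) \<partial>M)"
proof -
  interpret prob_space M by fact
  have [measurable_cong]: "sets \<nu> = sets borel"
    using levy by (simp add: levy_measure_def)
  let ?I = "\<lambda>g x. \<integral>u. (g (x + u) - g x)\<^sup>2 \<partial>\<nu>"
  \<comment> \<open>The first summand controls large jumps through \<open>K\<close>, the second
    small jumps through \<open>L\<close>; neither depends on the approximant.\<close>
  let ?C = "(2 * K)\<^sup>2 + (L * real DIM('a))\<^sup>2"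
  define B where "B = (\<integral>u. ?C * min 1 ((norm u)\<^sup>2) \<partial>\<nu>)"
  obtain p where p: "\<And>m::nat. trig_in Basis (p m)" "\<And>m x. \<bar>p m x\<bar> \<le> K"
    "\<And>m. coord_lipschitz L (p m)" and lim: "\<And>x. (\<lambda>m. p m x) \<longlonglongrightarrow> f x"
    by (rule trig_polynomial_pointwise_approx[OF bd lip \<open>L \<ge> 0\<close>], rule that)
  have meas: "g \<in> borel_measurable borel" if "coord_lipschitz L g" for g :: "'a \<Rightarrow> real"
    using coord_lipschitz_continuous_on[OF that \<open>L \<ge> 0\<close>] by (rule borel_measurable_continuous_onI)
  note [measurable] = meas[OF lip] meas[OF p(3)]
  have dom: "norm ((g (x + u) - g x)\<^sup>2) \<le> ?C * min 1 ((norm u)\<^sup>2)"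
    if "coord_lipschitz L g" "\<And>x. \<bar>g x\<bar> \<le> K" for g :: "'a \<Rightarrow> real" and x u
  proof -
    have "\<bar>g (x + u) - g x\<bar> \<le> 2 * K"
      using that(2)[of x] that(2)[of "x + u"] by linarith
    then have 1: "(g (x + u) - g x)\<^sup>2 \<le> (2 * K)\<^sup>2"
      by (rule power2_le_iff_abs_le[THEN iffD2, rotated]) (use that(2)[of x] in linarith)
    have "\<bar>g (x + u) - g x\<bar> \<le> L * real DIM('a) * norm u"
      using that(1) \<open>L \<ge> 0\<close> by (rule coord_lipschitzD_norm)
    then have 2: "(g (x + u) - g x)\<^sup>2 \<le> (L * real DIM('a) * norm u)\<^sup>2"
      by (rule power2_le_iff_abs_le[THEN iffD2, rotated]) (use \<open>L \<ge> 0\<close> in simp)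
    show ?thesis
    proof (cases "1 \<le> (norm u)\<^sup>2")
      case True
      then have "min 1 ((norm u)\<^sup>2) = 1" by simp
      then show ?thesis using 1 by (simp add: add_increasing2)
    next
      case False
      then have "min 1 ((norm u)\<^sup>2) = (norm u)\<^sup>2" by simp
      then show ?thesis using 2
        by (simp add: power_mult_distrib distrib_right add_increasing)
    qed
  qed
  have int_min: "integrable \<nu> (\<lambda>u. ?C * min 1 ((norm u)\<^sup>2))"
    by (intro integrable_mult_right levy_measure_integrable_min levy)
  \<comment> \<open>A bound uniform in \<open>m\<close> and \<open>x\<close> is integrable under the
    probability measure, so it dominates the outer integrals.\<close>
  have bI: "norm (?I (p m) x) \<le> B" for m x
  proof -
    have "norm (?I (p m) x) \<le> (\<integral>u. norm ((p m (x + u) - p m x)\<^sup>2) \<partial>\<nu>)"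
      by (rule integral_norm_bound)
    also have "\<dots> \<le> B"
      unfolding B_def
    proof (rule integral_mono[OF _ int_min])
      show "integrable \<nu> (\<lambda>u. norm ((p m (x + u) - p m x)\<^sup>2))"
        by (intro integrable_norm integrable_levy_measure[OF levy, of _ ?C] dom p) measurable
    qed (intro dom p)
    finally show ?thesis .
  qed
  have limI: "(\<lambda>m. ?I (p m) x) \<longlonglongrightarrow> ?I f x" for x
  proof (rule integral_dominated_convergence[OF _ _ int_min])
    show "AE u in \<nu>. (\<lambda>m. (p m (x + u) - p m x)\<^sup>2) \<longlonglongrightarrow> (f (x + u) - f x)\<^sup>2"
      by (intro AE_I2 tendsto_intros lim)
    show "AE u in \<nu>. norm ((p m (x + u) - p m x)\<^sup>2) \<le> ?C * min 1 ((norm u)\<^sup>2)" for m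
      by (intro AE_I2 dom p)
  qed measurable
  have trig: "(\<lambda>\<omega>. ?I (p m) (X \<omega>)) \<in> borel_measurable M"
    "(\<integral>\<omega>. (p m (X \<omega>))\<^sup>2 \<partial>M) - (\<integral>\<omega>. p m (X \<omega>) \<partial>M)\<^sup>2 \<le> (\<integral>\<omega>. ?I (p m) (X \<omega>) \<partial>M)" for m
  proof -
    obtain xs where "\<And>x. complex_of_real (p m x) = (\<Sum>(a, \<xi>)\<leftarrow>xs. a * cis (\<xi> \<bullet> x))"
      using trig_in_Basis_expansion[OF p(1)[of m]] by blast
    then have "\<And>x. complex_of_real (p m x) = (\<Sum>j\<in>{0..<length xs}. fst (xs ! j) * cis (snd (xs ! j) \<bullet> x))"
      by (simp add: sum_list_sum_nth case_prod_beta)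
    note * = poincare_trig_polynomial[OF assms(1-4) this]
    show "(\<lambda>\<omega>. ?I (p m) (X \<omega>)) \<in> borel_measurable M" by (rule *(1))
    show "(\<integral>\<omega>. (p m (X \<omega>))\<^sup>2 \<partial>M) - (\<integral>\<omega>. p m (X \<omega>) \<partial>M)\<^sup>2 \<le> (\<integral>\<omega>. ?I (p m) (X \<omega>) \<partial>M)"
      by (rule *(2))
  qed
  \<comment> \<open>Measurability is inherited from the trigonometric polynomials as a pointwise
    limit.\<close>
  have measI: "(\<lambda>\<omega>. ?I f (X \<omega>)) \<in> borel_measurable M"
    by (rule borel_measurable_LIMSEQ_metric[OF trig(1) limI])
  show ?thesis
  proof (rule LIMSEQ_le)
    show "(\<lambda>m. \<integral>\<omega>. ?I (p m) (X \<omega>) \<partial>M) \<longlonglongrightarrow> (\<integral>\<omega>. ?I f (X \<omega>) \<partial>M)"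
      by (rule integral_dominated_convergence[where w = "\<lambda>_. B"])
        (intro measI trig(1) AE_I2 limI bI integrable_const)+
    have "(\<lambda>m. \<integral>\<omega>. (p m (X \<omega>))\<^sup>2 \<partial>M) \<longlonglongrightarrow> (\<integral>\<omega>. (f (X \<omega>))\<^sup>2 \<partial>M)"
    proof (rule integral_dominated_convergence[where w = "\<lambda>_. K\<^sup>2"])
      show "AE \<omega> in M. norm ((p m (X \<omega>))\<^sup>2) \<le> K\<^sup>2" for m
        using power_mono[OF p(2) abs_ge_zero, of m _ 2] by simp
    qed (auto intro!: tendsto_intros lim)
    moreover have "(\<lambda>m. \<integral>\<omega>. p m (X \<omega>) \<partial>M) \<longlonglongrightarrow> (\<integral>\<omega>. f (X \<omega>) \<partial>M)"
    proof (rule integral_dominated_convergence[where w = "\<lambda>_. K"])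
      show "AE \<omega> in M. norm (p m (X \<omega>)) \<le> K" for m
        using p(2) by simp
    qed (auto intro: lim)
    ultimately show "(\<lambda>m. (\<integral>\<omega>. (p m (X \<omega>))\<^sup>2 \<partial>M) - (\<integral>\<omega>. p m (X \<omega>) \<partial>M)\<^sup>2)
        \<longlonglongrightarrow> (\<integral>\<omega>. (f (X \<omega>))\<^sup>2 \<partial>M) - (\<integral>\<omega>. f (X \<omega>) \<partial>M)\<^sup>2"
      by (intro tendsto_intros)
  qed (intro exI allI impI trig(2))
qed

theorem proposition5p1:
  fixes M :: "'w measure"
    and X :: "'w \<Rightarrow> 'a::euclidean_space"
    and \<nu> \<sigma> :: "'a measure"
    and k :: "'a \<Rightarrow> real \<Rightarrow> real"
    and f :: "'a \<Rightarrow> real"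
  assumes "prob_space M"
    and "self_decomposable M X \<nu>"
    and "centered M X"
    and "(\<integral>\<^sup>+u\<in>{u. 1 \<le> norm u}. ennreal (norm u) \<partial>\<nu>) < \<infinity>"
    and "finite_sphere_measure \<sigma>"
    and "has_polar_form \<nu> \<sigma> k"
    and "\<And>x r. x \<in> sphere 0 1 \<Longrightarrow> 0 < r \<Longrightarrow> 0 \<le> k x r"
    and "\<And>x. x \<in> sphere 0 1 \<Longrightarrow> continuous_on {0<..} (k x)"
    and "\<And>x. x \<in> sphere 0 1 \<Longrightarrow> antimono_on {0<..} (k x)"
    and "\<And>r. 0 < r \<Longrightarrow> continuous_on (sphere 0 1) (\<lambda>x. k x r)"
    and "\<And>x. x \<in> sphere 0 1 \<Longrightarrow> (k x \<longlongrightarrow> 0) at_top"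
    and "\<And>x. x \<in> sphere 0 1 \<Longrightarrow> ((\<lambda>r. r\<^sup>2 * k x r) \<longlongrightarrow> 0) (at_right 0)"
    and "f \<in> Cc_infinity"
    and "(\<integral>\<omega>. f (X \<omega>) \<partial>M) = 0"
  shows "(\<integral>\<omega>. (f (X \<omega>))\<^sup>2 \<partial>M)
      \<le> (\<integral>\<omega>. (\<integral>u. (f (X \<omega> + u) - f (X \<omega>))\<^sup>2 \<partial>\<nu>) \<partial>M)"
proof -
  obtain b where "X \<in> borel_measurable M" "levy_measure \<nu>" "levy_khintchine M X b \<nu>"
    using assms(2) unfolding self_decomposable_def by blast
  moreover obtain K L where "\<And>x. \<bar>f x\<bar> \<le> K" "L \<ge> 0" "coord_lipschitz L f"
    by (rule Cc_infinity_bounds[OF assms(13)], rule that)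
  ultimately have "(\<integral>\<omega>. (f (X \<omega>))\<^sup>2 \<partial>M) - (\<integral>\<omega>. f (X \<omega>) \<partial>M)\<^sup>2
      \<le> (\<integral>\<omega>. (\<integral>u. (f (X \<omega> + u) - f (X \<omega>))\<^sup>2 \<partial>\<nu>) \<partial>M)"
    by (intro poincare_levy_khintchine[OF assms(1)])
  \<comment> \<open>Since the mean is zero, the variance is the second moment.\<close>
  then show ?thesis
    unfolding assms(14) by simp
qed

end
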